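(* Let $(\omega_x)_{x\in\mathbb Z^2}$ be i.i.d. under $\mathbb P$ with $\mathbb E|\omega_0|^p<\infty$ for some $p>2$, $\mathrm{Var}(\omega_0)>0$, and $\mathbb P(\omega_0\ge c)=1$ for some $c>-\infty$. Let $\xi\in\mathrm{ri}\,\mathcal U$ with $\mathcal U_\xi=[\underline\xi,\overline\xi]$ satisfy $\underline\xi,\xi,\overline\xi\in\mathcal D$. Call a sequence $v_n\in\mathbb Z_+^2$ admissible if $|v_n|_1\to\infty$ and $\underline\xi\cdot e_1\le\varliminf_{n\to\infty} \frac{v_n\cdot e_1}{|v_n|_1}\le\varlimsup_{n\to\infty}\frac{v_n\cdot e_1}{|v_n|_1}\le\overline\xi\cdot e_1$. Let $B$ be the Busemann function: $B(\omega,x,y)=\lim_{n\to\infty}(G_{x,v_n}(\omega)-G_{y,v_n}(\omega))$ ($\mathbb P$-a.s. this limit exists for all $x,y\in\mathbb Z^2$ and all admissible sequences, and does not depend on the admissible sequence). The following events have $\mathbb P$-probability one. (i) Every up-right path $x_{0,\infty}$ such that $\omega_{x_k}=B(x_k,x_{k+1})$ for all $k\ge0$ is an infinite geodesic. (Call such a path a Busemann geodesic.) (ii) Every infinite geodesic $x_{0,\infty}$ that satisfies $$\underline\xi\cdot e_1\le\varliminf_{n\to\infty}\frac{x_n\cdot e_1}{n}\le\varlimsup_{n\to\infty}\frac{x_n\cdot e_1}{n}\le\overline\xi\cdot e_1$$ is a Busemann geodesic. (iii) For each $m\ge0$ and each admissible sequence $v_n$ there exists $n_0$ such that if $n\ge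 n_0$, then for any geodesic $x_{0,|v_n|_1}$ from $x_0=0$ to $v_n$ we have $B(\omega,x_i,x_{i+1})=\omega_{x_i}$ for all $0\le i\le m$.
   Context: Here $e_1=(1,0)$, $e_2=(0,1)$, $|x|_1$ is the $\ell^1$ norm, $x\le y$ is coordinatewise. $\mathbb P$ is a Borel probability measure on $\Omega=\mathbb R^{\mathbb Z^2}\ni\omega=(\omega_x)$. Up-right paths have steps in $\{e_1,e_2\}$. For $x\le y$, $G_{x,y}=\max\sum_{k=0}^{n-1}\omega_{x_k}$ over up-right paths $x=x_0,\dots,x_n=y$, $n=|y-x|_1$. The a.s. deterministic limit $g_{\rm pp}(\xi)=\lim n^{-1}G_{0,\lfloor n\xi\rfloor}$ ($\xi\in\mathbb R_+^2$) is continuous, concave, symmetric, 1-homogeneous. $\mathcal U=\{te_1+(1-t)e_2:t\in[0,1]\}$, $\mathrm{ri}\,\mathcal U$ its relative interior ($t\in(0,1)$), $\mathcal D=\{\xi\in\mathrm{ri}\,\mathcal U: g_{\rm pp}\text{ is differentiable at }\xi\}$. One-sided gradients: $\nabla g_{\rm pp}(\zeta\pm)\cdot e_1=\lim_{\varepsilon\searrow0}\frac{g_{\rm pp}(\zeta\pm\varepsilon e_1)-g_{\rm pp}(\zeta)}{\pm\varepsilon}$, $\nabla g_{\rm pp}(\zeta\pm)\cdot e_2=\lim_{\varepsilon\searrow0}\frac{g_{\rm pp}(\zeta\mp\varepsilon e_2)-g_{\rm pp}(\zeta)}{\mp\varepsilon}$. $\mathcal U_{\xi\pm}=\{\zeta\in\mathrm{ri}\,\mathcal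 U: g_{\rm pp}(\zeta)-g_{\rm pp}(\xi)=\nabla g_{\rm pp}(\xi\pm)\cdot(\zeta-\xi)\}$ and $\mathcal U_\xi=\mathcal U_{\xi-}\cup\mathcal U_{\xi+}=[\underline\xi,\overline\xi]$, $\underline\xi\cdot e_1\le\overline\xi\cdot e_1$. A finite up-right path from $u$ to $v$ is a geodesic if $G_{u,v}=\sum_{k=0}^{n-1}\omega_{x_k}$. An infinite up-right path $x_{0,\infty}$ is an infinite geodesic if every segment $(x_k)_{k=i}^j$ is a geodesic from $x_i$ to $x_j$. *)

theory Defs
  imports "HOL-Probability.Probability"
begin

type_synonym site = "int \<times> int"
type_synonym env = "site \<Rightarrow> real"

abbreviation e1 :: "'a::{zero,one} \<times> 'a" where "e1 \<equiv> (1, 0)"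
abbreviation e2 :: "'a::{zero,one} \<times> 'a" where "e2 \<equiv> (0, 1)"

definition l1 :: "site \<Rightarrow> nat" where
  "l1 x = nat (\<bar>fst x\<bar> + \<bar>snd x\<bar>)"

text \<open>A path with \<open>n\<close> steps is a function on \<open>nat\<close> of which only the values at
  \<open>0, \<dots>, n\<close> are relevant.\<close>

definition up_right_path :: "nat \<Rightarrow> (nat \<Rightarrow> site) \<Rightarrow> bool" where
  "up_right_path n x \<longleftrightarrow> (\<forall>k<n. x (Suc k) - x k \<in> {e1, e2})"

definition path_between :: "site \<Rightarrow> site \<Rightarrow> (nat \<Rightarrow> site) \<Rightarrow> bool" where
  "path_between u v x \<longleftrightarrow> up_right_path (l1 (v - u)) x \<and> x 0 = u \<and> x (l1 (v - u)) = v"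

definition passage :: "env \<Rightarrow> nat \<Rightarrow> (nat \<Rightarrow> site) \<Rightarrow> real" where
  "passage \<omega> n x = (\<Sum>k<n. \<omega> (x k))"

text \<open>Meaningful only for \<open>u \<le> v\<close> coordinatewise; otherwise there is no path from
  \<open>u\<close> to \<open>v\<close> and the value is unspecified. The last site \<open>v\<close> is not counted.\<close>

definition G :: "env \<Rightarrow> site \<Rightarrow> site \<Rightarrow> real" where
  "G \<omega> u v = Max {passage \<omega> (l1 (v - u)) x | x. path_between u v x}"

definition geodesic :: "env \<Rightarrow> site \<Rightarrow> site \<Rightarrow> (nat \<Rightarrow> site) \<Rightarrow> bool" where
  "geodesic \<omega> u v x \<longleftrightarrow> path_between u v x \<and> G \<omega> u v = passage \<omega> (l1 (v - u)) x"

definition infinite_path :: "(nat \<Rightarrow> site) \<Rightarrow> bool" where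
  "infinite_path x \<longleftrightarrow> (\<forall>k. x (Suc k) - x k \<in> {e1, e2})"

definition infinite_geodesic :: "env \<Rightarrow> (nat \<Rightarrow> site) \<Rightarrow> bool" where
  "infinite_geodesic \<omega> x \<longleftrightarrow> infinite_path x \<and>
     (\<forall>i j. i \<le> j \<longrightarrow> geodesic \<omega> (x i) (x j) (\<lambda>k. x (i + k)))"

definition floor2 :: "real \<times> real \<Rightarrow> site" where
  "floor2 \<zeta> = (\<lfloor>fst \<zeta>\<rfloor>, \<lfloor>snd \<zeta>\<rfloor>)"

text \<open>The deterministic constant that is almost surely the limit; only its values on the
  closed quadrant are relevant.\<close>

definition gpp :: "env measure \<Rightarrow> real \<times> real \<Rightarrow> real" where
  "gpp P \<zeta> = (THE L. AE \<omega> in P. (\<lambda>n. G \<omega> 0 (floor2 (real n *\<^sub>R \<zeta>)) / real n) \<longlonglongrightarrow> L)"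

definition simplex_U :: "(real \<times> real) set" where
  "simplex_U = {t *\<^sub>R e1 + (1 - t) *\<^sub>R e2 | t. t \<in> {0..1}}"

abbreviation ri_U :: "(real \<times> real) set" where
  "ri_U \<equiv> rel_interior simplex_U"

definition diff_points :: "(real \<times> real \<Rightarrow> real) \<Rightarrow> (real \<times> real) set" where
  "diff_points g = {\<zeta> \<in> ri_U. g differentiable (at \<zeta>)}"

text \<open>The gradients \<open>\<nabla>g(\<zeta>+)\<close> and \<open>\<nabla>g(\<zeta>-)\<close>: in the second component the increments have the
  opposite sign, i.e. both components are taken towards the same side along \<open>simplex_U\<close>.\<close>

definition grad_plus :: "(real \<times> real \<Rightarrow> real) \<Rightarrow> real \<times> real \<Rightarrow> real \<times> real" where
  "grad_plus g \<zeta> =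
    (Lim (at_right 0) (\<lambda>\<epsilon>. (g (\<zeta> + \<epsilon> *\<^sub>R e1) - g \<zeta>) / \<epsilon>),
     Lim (at_right 0) (\<lambda>\<epsilon>. (g (\<zeta> - \<epsilon> *\<^sub>R e2) - g \<zeta>) / (- \<epsilon>)))"

definition grad_minus :: "(real \<times> real \<Rightarrow> real) \<Rightarrow> real \<times> real \<Rightarrow> real \<times> real" where
  "grad_minus g \<zeta> =
    (Lim (at_right 0) (\<lambda>\<epsilon>. (g (\<zeta> - \<epsilon> *\<^sub>R e1) - g \<zeta>) / (- \<epsilon>)),
     Lim (at_right 0) (\<lambda>\<epsilon>. (g (\<zeta> + \<epsilon> *\<^sub>R e2) - g \<zeta>) / \<epsilon>))"

definition U_plus :: "(real \<times> real \<Rightarrow> real) \<Rightarrow> real \<times> real \<Rightarrow> (real \<times> real) set" where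
  "U_plus g \<xi> = {\<zeta> \<in> ri_U. g \<zeta> - g \<xi> = grad_plus g \<xi> \<bullet> (\<zeta> - \<xi>)}"

definition U_minus :: "(real \<times> real \<Rightarrow> real) \<Rightarrow> real \<times> real \<Rightarrow> (real \<times> real) set" where
  "U_minus g \<xi> = {\<zeta> \<in> ri_U. g \<zeta> - g \<xi> = grad_minus g \<xi> \<bullet> (\<zeta> - \<xi>)}"

definition U_at :: "(real \<times> real \<Rightarrow> real) \<Rightarrow> real \<times> real \<Rightarrow> (real \<times> real) set" where
  "U_at g \<xi> = U_minus g \<xi> \<union> U_plus g \<xi>"

definition admissible :: "real \<times> real \<Rightarrow> real \<times> real \<Rightarrow> (nat \<Rightarrow> site) \<Rightarrow> bool" where
  "admissible \<xi>l \<xi>r v \<longleftrightarrow>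
     (\<forall>n. 0 \<le> fst (v n) \<and> 0 \<le> snd (v n)) \<and>
     filterlim (\<lambda>n. l1 (v n)) at_top sequentially \<and>
     ereal (fst \<xi>l) \<le> liminf (\<lambda>n. ereal (real_of_int (fst (v n)) / real (l1 (v n)))) \<and>
     limsup (\<lambda>n. ereal (real_of_int (fst (v n)) / real (l1 (v n)))) \<le> ereal (fst \<xi>r)"

text \<open>\<open>B\<close> is (a version of) the Busemann function: outside a single null set, it is the
  limit of \<open>G \<omega> x (v n) - G \<omega> y (v n)\<close> for all \<open>x\<close>, \<open>y\<close> and all admissible \<open>v\<close>
  simultaneously. This determines \<open>B\<close> up to a null set of environments.\<close>

definition is_busemann ::
  "env measure \<Rightarrow> real \<times> real \<Rightarrow> real \<times> real \<Rightarrow> (env \<Rightarrow> site \<Rightarrow> site \<Rightarrow> real) \<Rightarrow> bool" where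
  "is_busemann P \<xi>l \<xi>r B \<longleftrightarrow>
     (AE \<omega> in P. \<forall>x y v. admissible \<xi>l \<xi>r v \<longrightarrow>
        (\<lambda>n. G \<omega> x (v n) - G \<omega> y (v n)) \<longlonglongrightarrow> B \<omega> x y)"

definition busemann_geodesic ::
  "(env \<Rightarrow> site \<Rightarrow> site \<Rightarrow> real) \<Rightarrow> env \<Rightarrow> (nat \<Rightarrow> site) \<Rightarrow> bool" where
  "busemann_geodesic B \<omega> x \<longleftrightarrow>
     infinite_path x \<and> (\<forall>k. \<omega> (x k) = B \<omega> (x k) (x (Suc k)))"

end

theory Submission
  imports Defs "HOL-Real_Asymp.Real_Asymp"
begin

text \<open>Once an environment is fixed for which the Busemann limits exist, everything is
  deterministic. Superadditivity \<open>G a v \<ge> \<omega> a + G b v\<close> along an edge \<open>(a, b)\<close> passes to the limit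
  as \<open>\<omega> a \<le> B a b\<close>, and since \<open>B\<close> is a cocycle, summing along paths shows that paths with
  equality everywhere are maximal. Conversely, \<open>G a v - G b v = \<omega> a\<close> along every edge of a
  geodesic ending at \<open>v\<close>; letting \<open>v\<close> go to infinity yields \<open>B a b = \<omega> a\<close>, and since only
  finitely many edges lie within distance \<open>m\<close> of the origin, this equality is reached on all
  of them at once.\<close>

section \<open>Up-right paths, attainment of the maximum in \<open>G\<close>, and edge
  increments\<close>

lemma up_right_path_mono:
  assumes "up_right_path n x" "i \<le> j" "j \<le> n"
  shows "fst (x i) \<le> fst (x j)" "snd (x i) \<le> snd (x j)"
    and "fst (x j) + snd (x j) = fst (x i) + snd (x i) + int (j - i)"
proof -
  have "fst (x i) \<le> fst (x j) \<and> snd (x i) \<le> snd (x j) \<and>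
      fst (x j) + snd (x j) = fst (x i) + snd (x i) + int (j - i)"
    using assms(2,3)
  proof (induction rule: dec_induct)
    case base
    show ?case by simp
  next
    case (step k)
    have "x (Suc k) - x k = (1, 0) \<or> x (Suc k) - x k = (0, 1)"
      using assms(1) step by (auto simp: up_right_path_def)
    then have "fst (x (Suc k)) - fst (x k) = 1 \<and> snd (x (Suc k)) - snd (x k) = 0 \<or>
        fst (x (Suc k)) - fst (x k) = 0 \<and> snd (x (Suc k)) - snd (x k) = 1"
      by (metis fst_conv fst_diff snd_conv snd_diff)
    then show ?case using step by (auto simp: Suc_diff_le)
  qed
  then show "fst (x i) \<le> fst (x j)" "snd (x i) \<le> snd (x j)"
    "fst (x j) + snd (x j) = fst (x i) + snd (x i) + int (j - i)" by auto
qed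

lemma l1_up_right_path:
  assumes "up_right_path n x" "i \<le> j" "j \<le> n"
  shows "l1 (x j - x i) = j - i"
  using up_right_path_mono[OF assms] by (simp add: l1_def)

lemma infinite_path_imp_up_right_path: "infinite_path x \<Longrightarrow> up_right_path n x"
  by (simp add: infinite_path_def up_right_path_def)

lemma passage_Suc_shift: "passage \<omega> (Suc n) x = \<omega> (x 0) + passage \<omega> n (\<lambda>k. x (Suc k))"
  by (simp add: passage_def sum.lessThan_Suc_shift del: sum.lessThan_Suc)

text \<open>There are infinitely many functions representing one path, but \<open>passage\<close>
  sees only the restriction to \<open>{..l1 (v - u)}\<close>, whose values stay in the box spanned
  by \<open>u\<close> and \<open>v\<close>. Finiteness is what gives \<open>Max\<close> in
  \<open>G\<close> its meaning.\<close>

lemma finite_passages: "finite {passage \<omega> (l1 (v - u)) x | x. path_between u v x}"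
proof -
  let ?n = "l1 (v - u)"
  let ?S = "PiE {..?n} (\<lambda>_. {fst u..fst v} \<times> {snd u..snd v})"
  have "{passage \<omega> ?n x | x. path_between u v x} \<subseteq> passage \<omega> ?n ` ?S"
  proof
    fix t assume "t \<in> {passage \<omega> ?n x | x. path_between u v x}"
    then obtain x where x: "path_between u v x" "t = passage \<omega> ?n x" by auto
    then have p: "up_right_path ?n x" "x 0 = u" "x ?n = v" by (auto simp: path_between_def)
    have "x k \<in> {fst u..fst v} \<times> {snd u..snd v}" if "k \<le> ?n" for k
      using up_right_path_mono[OF p(1), of 0 k] up_right_path_mono[OF p(1), of k ?n] that p(2,3)
      by (auto simp: mem_Times_iff)
    then have "restrict x {..?n} \<in> ?S" by auto
    moreover have "t = passage \<omega> ?n (restrict x {..?n})"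
      unfolding x(2) passage_def by (intro sum.cong) auto
    ultimately show "t \<in> passage \<omega> ?n ` ?S" by blast
  qed
  then show ?thesis by (rule finite_subset) (intro finite_imageI finite_PiE, auto)
qed

lemma path_between_exists:
  assumes "fst u \<le> fst v" "snd u \<le> snd v"
  shows "\<exists>x. path_between u v x"
proof -
  define a where "a = nat (fst v - fst u)"
  \<comment> \<open>All horizontal steps come first; truncated subtraction keeps the second
    coordinate fixed until \<open>k\<close> reaches \<open>a\<close>.\<close>
  define x where "x k = (fst u + int (min k a), snd u + int (k - a))" for k
  have "up_right_path (l1 (v - u)) x"
    unfolding up_right_path_def
  proof (intro allI impI)
    fix k
    show "x (Suc k) - x k \<in> {e1, e2}" by (cases "k < a") (auto simp: x_def Suc_diff_le)
  qed
  moreover have "l1 (v - u) = a + nat (snd v - snd u)"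
    using assms by (simp add: l1_def a_def nat_add_distrib)
  then have "x (l1 (v - u)) = v" using assms by (simp add: x_def a_def)
  ultimately show ?thesis by (auto simp: path_between_def x_def)
qed

lemma passage_le_G: "path_between u v x \<Longrightarrow> passage \<omega> (l1 (v - u)) x \<le> G \<omega> u v"
  unfolding G_def by (rule Max_ge[OF finite_passages]) auto

lemma geodesic_exists:
  assumes "fst u \<le> fst v" "snd u \<le> snd v"
  shows "\<exists>x. geodesic \<omega> u v x"
proof -
  have "G \<omega> u v \<in> {passage \<omega> (l1 (v - u)) x | x. path_between u v x}"
    unfolding G_def using path_between_exists[OF assms] by (intro Max_in finite_passages) auto
  then show ?thesis by (auto simp: geodesic_def)
qed

text \<open>The terminal site is not counted, so the sum is empty. This is the end value of the
  telescoping sum in \<open>geodesic_G_diff\<close>.\<close>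

lemma G_self [simp]: "G \<omega> v v = 0"
proof -
  obtain x where "geodesic \<omega> v v x" using geodesic_exists[of v v] by auto
  then show ?thesis by (simp add: geodesic_def passage_def l1_def)
qed

text \<open>Prepending \<open>a\<close> to a geodesic from \<open>b\<close> to \<open>v\<close>
  gives a competitor for \<open>G \<omega> a v\<close>. The order hypotheses guarantee that such a
  geodesic exists.\<close>

lemma G_superadditive:
  assumes step: "b - a \<in> {e1, e2}" and le: "fst b \<le> fst v" "snd b \<le> snd v"
  shows "\<omega> a + G \<omega> b v \<le> G \<omega> a v"
proof -
  obtain x where x: "geodesic \<omega> b v x" using geodesic_exists[OF le] by blast
  define y where "y k = (case k of 0 \<Rightarrow> a | Suc j \<Rightarrow> x j)" for k
  have ba: "b = a + (1, 0) \<or> b = a + (0, 1)" using step by (auto simp: algebra_simps)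
  have l: "l1 (v - a) = Suc (l1 (v - b))"
    using ba le by (auto simp: l1_def nat_add_distrib)
  have "path_between a v y"
    using x step unfolding geodesic_def path_between_def up_right_path_def l
    by (auto simp: y_def less_Suc_eq_0_disj)
  from passage_le_G[OF this, of \<omega>] show ?thesis
    using x unfolding l passage_Suc_shift by (simp add: y_def geodesic_def)
qed

text \<open>Superadditivity makes every edge defect nonnegative. The defects telescope to
  \<open>G \<omega> u v - G \<omega> v v\<close> minus the passage value, which is 0 for a geodesic,
  so each of them vanishes.\<close>

lemma geodesic_G_diff:
  assumes geo: "geodesic \<omega> u v x" and i: "i < l1 (v - u)"
  shows "G \<omega> (x i) v - G \<omega> (x (Suc i)) v = \<omega> (x i)"
proof -
  let ?n = "l1 (v - u)"
  have p: "up_right_path ?n x" "x 0 = u" "x ?n = v" and G: "G \<omega> u v = passage \<omega> ?n x"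
    using geo by (auto simp: geodesic_def path_between_def)
  have ge: "0 \<le> G \<omega> (x k) v - G \<omega> (x (Suc k)) v - \<omega> (x k)" if "k < ?n" for k
    using G_superadditive[of "x (Suc k)" "x k" v \<omega>] up_right_path_mono[OF p(1), of "Suc k" ?n]
      p that by (auto simp: up_right_path_def)
  have "(\<Sum>k<?n. G \<omega> (x k) v - G \<omega> (x (Suc k)) v - \<omega> (x k)) = 0"
    using sum_lessThan_telescope'[of "\<lambda>k. G \<omega> (x k) v" ?n] G p
    by (simp add: passage_def sum_subtractf[of _ "\<lambda>k. \<omega> (x k)"])
  then have "G \<omega> (x i) v - G \<omega> (x (Suc i)) v - \<omega> (x i) = 0"
    using ge i by (subst (asm) sum_nonneg_eq_0_iff) auto
  then show ?thesis by simp
qed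

section \<open>Directions and admissible sequences\<close>

lemma fst_ri_U:
  assumes "\<zeta> \<in> ri_U"
  shows "0 < fst \<zeta>" "fst \<zeta> < 1"
proof -
  \<comment> \<open>The segment runs from \<open>e2\<close> to \<open>e1\<close>, so its parameter
    is the first coordinate.\<close>
  have "simplex_U = closed_segment (0, 1) (1, 0)"
    unfolding simplex_U_def closed_segment_def by (auto; force)
  then have "\<zeta> \<in> open_segment (0, 1) (1, 0)"
    using assms rel_interior_closed_segment[of "(0, 1) :: real \<times> real" "(1, 0)"] by simp
  then show "0 < fst \<zeta>" "fst \<zeta> < 1" by (auto simp: in_segment)
qed

text \<open>Directions bounded away from both axes force both coordinates of \<open>v n\<close> to
  grow at least linearly in \<open>l1 (v n)\<close>. This ensures that
  \<open>G \<omega> a (v n)\<close> is eventually a genuine maximum.\<close>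

lemma admissible_eventually_ge:
  assumes v: "admissible \<xi>l \<xi>r v" and \<xi>: "0 < fst \<xi>l" "fst \<xi>r < 1"
  shows "\<forall>\<^sub>F n in sequentially. fst a \<le> fst (v n) \<and> snd a \<le> snd (v n)"
proof -
  have pos: "0 \<le> fst (v n)" "0 \<le> snd (v n)" for n using v by (auto simp: admissible_def)
  have l1: "filterlim (\<lambda>n. real (l1 (v n))) at_top sequentially"
    using v filterlim_compose[OF filterlim_real_sequentially] by (auto simp: admissible_def)
  \<comment> \<open>Midpoints towards 0 and 1 leave the strict slack needed to turn liminf and
    limsup bounds into eventual ones.\<close>
  define s where "s = fst \<xi>l / 2"
  define t where "t = (1 + fst \<xi>r) / 2"
  have st: "0 < s" "s < fst \<xi>l" "fst \<xi>r < t" "t < 1" using \<xi> by (auto simp: s_def t_def)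
  have "\<forall>\<^sub>F n in sequentially. ereal s < ereal (real_of_int (fst (v n)) / real (l1 (v n)))"
    using v st by (intro less_LiminfD) (auto simp: admissible_def intro: less_le_trans[rotated])
  moreover have "\<forall>\<^sub>F n in sequentially. ereal (real_of_int (fst (v n)) / real (l1 (v n))) < ereal t"
    using v st by (intro Limsup_lessD) (auto simp: admissible_def intro: le_less_trans)
  moreover have "\<forall>\<^sub>F n in sequentially. real_of_int \<bar>fst a\<bar> / s < real (l1 (v n))"
    using l1 by (simp add: filterlim_at_top_dense)
  moreover have "\<forall>\<^sub>F n in sequentially. real_of_int \<bar>snd a\<bar> / (1 - t) < real (l1 (v n))"
    using l1 by (simp add: filterlim_at_top_dense)
  ultimately show ?thesis
  proof eventually_elim
    case (elim n)
    have "0 \<le> real_of_int \<bar>fst a\<bar> / s" using st by simp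
    with elim have L: "0 < real (l1 (v n))" by linarith
    have "real_of_int (fst (v n)) + real_of_int (snd (v n)) = real (l1 (v n))"
      using pos[of n] by (simp add: l1_def)
    moreover have "s * real (l1 (v n)) < fst (v n)" "fst (v n) < t * real (l1 (v n))"
      using elim L by (simp_all add: field_simps)
    moreover have "real_of_int \<bar>fst a\<bar> < s * real (l1 (v n))"
      "real_of_int \<bar>snd a\<bar> < (1 - t) * real (l1 (v n))"
      using elim st by (simp_all add: pos_divide_less_eq mult.commute)
    ultimately have "real_of_int \<bar>fst a\<bar> < fst (v n)" "real_of_int \<bar>snd a\<bar> < snd (v n)"
      by (auto simp: algebra_simps)
    then show ?case by linarith
  qed
qed

text \<open>Properties of the Busemann limit can be extracted only along some admissible sequence;
  lattice points following the direction of \<open>\<xi>l\<close> provide one.\<close>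

lemma admissible_exists:
  assumes "0 < fst \<xi>l" "fst \<xi>l < 1" "fst \<xi>l \<le> fst \<xi>r"
  shows "\<exists>v. admissible \<xi>l \<xi>r v"
proof -
  define t where "t = fst \<xi>l"
  \<comment> \<open>Taking the complement in the second coordinate, rather than a second floor,
    makes the norm exactly \<open>n\<close>.\<close>
  define v where "v n = (\<lfloor>real n * t\<rfloor>, int n - \<lfloor>real n * t\<rfloor>)" for n :: nat
  have pos: "0 \<le> \<lfloor>real n * t\<rfloor>" "\<lfloor>real n * t\<rfloor> \<le> int n" for n
  proof -
    have "real n * t \<le> real n" "0 \<le> real n * t"
      using assms by (auto simp: t_def intro!: mult_left_le)
    then show "0 \<le> \<lfloor>real n * t\<rfloor>" "\<lfloor>real n * t\<rfloor> \<le> int n" by linarith+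
  qed
  have l: "l1 (v n) = n" for n using pos[of n] by (simp add: l1_def v_def)
  have "(\<lambda>n. real_of_int \<lfloor>real n * t\<rfloor> / real n) \<longlonglongrightarrow> t"
  proof (rule tendsto_sandwich)
    show "\<forall>\<^sub>F n in sequentially. t - 1 / real n \<le> real_of_int \<lfloor>real n * t\<rfloor> / real n"
      using eventually_gt_at_top[of 0]
    proof eventually_elim
      case (elim n)
      have "real n * t - 1 \<le> real_of_int \<lfloor>real n * t\<rfloor>" by linarith
      then have "(real n * t - 1) / real n \<le> real_of_int \<lfloor>real n * t\<rfloor> / real n"
        by (rule divide_right_mono) simp
      then show ?case using elim by (simp add: diff_divide_distrib)
    qed
    show "\<forall>\<^sub>F n in sequentially. real_of_int \<lfloor>real n * t\<rfloor> / real n \<le> t"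
      using eventually_gt_at_top[of 0]
      by eventually_elim (simp add: pos_divide_le_eq mult.commute)
    show "(\<lambda>n. t - 1 / real n) \<longlonglongrightarrow> t"
      using tendsto_diff[OF tendsto_const lim_1_over_n, of t] by simp
  qed simp
  then have "(\<lambda>n. ereal (real_of_int (fst (v n)) / real (l1 (v n)))) \<longlonglongrightarrow> ereal t"
    by (simp add: l) (simp add: v_def)
  from lim_imp_Liminf[OF _ this] lim_imp_Limsup[OF _ this]
  have "admissible \<xi>l \<xi>r v"
    using assms pos unfolding admissible_def l by (auto simp: t_def v_def filterlim_ident)
  then show ?thesis by blast
qed

text \<open>The shift by \<open>N\<close> is needed because admissible sequences stay in the closed quadrant.\<close>

lemma infinite_path_admissible:
  assumes x: "infinite_path x" and \<xi>: "0 < fst \<xi>l" "fst \<xi>r < 1"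
    and inf: "ereal (fst \<xi>l) \<le> liminf (\<lambda>n. ereal (real_of_int (fst (x n)) / real n))"
    and sup: "limsup (\<lambda>n. ereal (real_of_int (fst (x n)) / real n)) \<le> ereal (fst \<xi>r)"
  obtains N where "admissible \<xi>l \<xi>r (\<lambda>n. x (n + N))"
proof -
  \<comment> \<open>The path may start on any antidiagonal: inside the quadrant
    \<open>l1 (x n)\<close> is \<open>c + n\<close>, while the hypotheses normalise by
    \<open>n\<close>.\<close>
  define c where "c = fst (x 0) + snd (x 0)"
  have sum: "fst (x n) + snd (x n) = c + int n" for n
    using up_right_path_mono(3)[OF infinite_path_imp_up_right_path[OF x], of 0 n n]
    by (simp add: c_def)
  define t where "t = (1 + fst \<xi>r) / 2"
  have t: "fst \<xi>r < t" "t < 1" using \<xi> by (auto simp: t_def)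
  have "\<forall>\<^sub>F n in sequentially. ereal 0 < ereal (real_of_int (fst (x n)) / real n)"
    using inf \<xi> by (intro less_LiminfD) (auto intro: less_le_trans[rotated])
  moreover have "\<forall>\<^sub>F n in sequentially. ereal (real_of_int (fst (x n)) / real n) < ereal t"
    using sup t by (intro Limsup_lessD) (auto intro: le_less_trans)
  moreover have "\<forall>\<^sub>F n in sequentially. real_of_int \<bar>c\<bar> / (1 - t) < real n"
    using filterlim_real_sequentially by (simp add: filterlim_at_top_dense)
  ultimately have "\<forall>\<^sub>F n in sequentially. 0 \<le> fst (x n) \<and> 0 \<le> snd (x n)"
  proof eventually_elim
    case (elim n)
    have "0 \<le> real_of_int \<bar>c\<bar> / (1 - t)" using t by simp
    with elim have n: "0 < real n" by linarith
    have "0 < real_of_int (fst (x n))" "fst (x n) < t * real n"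
      using elim n by (simp_all add: field_simps)
    moreover have "real_of_int \<bar>c\<bar> < (1 - t) * real n"
      using elim t by (simp add: pos_divide_less_eq mult.commute)
    moreover have "real_of_int (fst (x n)) + real_of_int (snd (x n)) = real_of_int c + real n"
      using sum[of n] by (metis of_int_add of_int_of_nat_eq)
    ultimately have "0 < real_of_int (fst (x n))" "0 < real_of_int (snd (x n))"
      by (auto simp: algebra_simps)
    then show ?case by linarith
  qed
  then obtain N where N: "\<And>n. n \<ge> N \<Longrightarrow> 0 \<le> fst (x n) \<and> 0 \<le> snd (x n)"
    by (auto simp: eventually_sequentially)
  have l: "real (l1 (x (n + N))) = real_of_int c + real (n + N)" for n
    using N[of "n + N"] sum[of "n + N"] by (simp add: l1_def)
  \<comment> \<open>This factor converts normalisation by the number of steps into normalisation by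
    the norm; since it tends to 1, liminf and limsup are unchanged.\<close>
  have tendsto: "(\<lambda>n. real (n + N) / (real_of_int c + real (n + N))) \<longlonglongrightarrow> 1"
    by real_asymp
  define r where "r n = ereal (real_of_int (fst (x n)) / real n)" for n
  have ratio: "\<forall>\<^sub>F n in sequentially.
      ereal (real (n + N) / (real_of_int c + real (n + N))) * r (n + N) =
      ereal (real_of_int (fst (x (n + N))) / real (l1 (x (n + N))))"
    using eventually_gt_at_top[of 0] by eventually_elim (simp add: r_def l)
  have r: "ereal (fst \<xi>l) \<le> liminf (\<lambda>n. r (n + N))" "limsup (\<lambda>n. r (n + N)) \<le> ereal (fst \<xi>r)"
    unfolding liminf_shift_k limsup_shift_k using inf sup by (simp_all add: r_def[abs_def])
  have "ereal (fst \<xi>l) \<le> liminf (\<lambda>n. ereal (real_of_int (fst (x (n + N))) / real (l1 (x (n + N)))))"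
    unfolding Liminf_eq[OF ratio, symmetric]
    by (subst ereal_liminf_lim_mult[of _ 1]) (use tendsto r in \<open>auto simp: one_ereal_def\<close>)
  moreover have "limsup (\<lambda>n. ereal (real_of_int (fst (x (n + N))) / real (l1 (x (n + N))))) \<le> ereal (fst \<xi>r)"
    unfolding Limsup_eq[OF ratio, symmetric]
    by (subst ereal_limsup_lim_mult[of _ 1]) (use tendsto r in \<open>auto simp: one_ereal_def\<close>)
  moreover have "filterlim (\<lambda>n. real (l1 (x (n + N)))) at_top sequentially"
    unfolding l by real_asymp
  then have "filterlim (\<lambda>n. l1 (x (n + N))) at_top sequentially"
    by (simp add: filterlim_sequentially_iff_filterlim_real)
  ultimately have "admissible \<xi>l \<xi>r (\<lambda>n. x (n + N))"
    using N by (auto simp: admissible_def)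
  then show thesis by (rule that)
qed

section \<open>Busemann limits in one fixed environment\<close>

locale busemann_environment =
  fixes \<omega> :: env and b :: "site \<Rightarrow> site \<Rightarrow> real" and \<xi>l \<xi>r :: "real \<times> real"
  assumes lim: "\<And>x y v. admissible \<xi>l \<xi>r v \<Longrightarrow> (\<lambda>n. G \<omega> x (v n) - G \<omega> y (v n)) \<longlonglongrightarrow> b x y"
    and pos: "0 < fst \<xi>l" and le: "fst \<xi>l \<le> fst \<xi>r" and less1: "fst \<xi>r < 1"
begin

text \<open>The identity holds exactly for the differences of \<open>G\<close> before the limit, so
  a single admissible sequence suffices.\<close>

lemma cocycle: "b x z = b x y + b y z"
proof -
  obtain v where v: "admissible \<xi>l \<xi>r v" using admissible_exists[of \<xi>l \<xi>r] pos le less1 by auto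
  have "(\<lambda>n. G \<omega> x (v n) - G \<omega> z (v n)) \<longlonglongrightarrow> b x y + b y z"
    using tendsto_add[OF lim[OF v, of x y] lim[OF v, of y z]] by simp
  then show ?thesis using lim[OF v] LIMSEQ_unique by blast
qed

lemma sum_telescope: "(\<Sum>k<n. b (x k) (x (Suc k))) = b (x 0) (x n)"
proof (induction n)
  case 0
  \<comment> \<open>The cocycle identity at three equal points forces
    \<open>b (x 0) (x 0) = 0\<close>.\<close>
  show ?case using cocycle[of "x 0" "x 0" "x 0"] by simp
next
  case (Suc n)
  then show ?case using cocycle[of "x 0" "x (Suc n)" "x n"] by simp
qed

lemma weight_le:
  assumes "z - y \<in> {e1, e2}"
  shows "\<omega> y \<le> b y z"
proof -
  obtain v where v: "admissible \<xi>l \<xi>r v" using admissible_exists[of \<xi>l \<xi>r] pos le less1 by auto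
  have "\<forall>\<^sub>F n in sequentially. \<omega> y \<le> G \<omega> y (v n) - G \<omega> z (v n)"
    using admissible_eventually_ge[OF v pos less1, of z]
    by eventually_elim (use G_superadditive[OF assms, of _ \<omega>] in \<open>auto simp: algebra_simps\<close>)
  then show ?thesis using tendsto_lowerbound[OF lim[OF v]] by simp
qed

text \<open>After telescoping, the edgewise bound depends only on the endpoints, so it bounds all
  competing paths at once.\<close>

lemma passage_le_busemann:
  assumes "path_between u w y"
  shows "passage \<omega> (l1 (w - u)) y \<le> b u w"
proof -
  have "passage \<omega> (l1 (w - u)) y \<le> (\<Sum>k<l1 (w - u). b (y k) (y (Suc k)))"
    unfolding passage_def
    using assms by (intro sum_mono weight_le) (auto simp: path_between_def up_right_path_def)
  then show ?thesis using assms by (simp add: sum_telescope path_between_def)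
qed

lemma busemann_path_imp_infinite_geodesic:
  assumes x: "infinite_path x" and eq: "\<And>k. \<omega> (x k) = b (x k) (x (Suc k))"
  shows "infinite_geodesic \<omega> x"
  unfolding infinite_geodesic_def
proof (intro conjI allI impI x)
  fix i j :: nat assume ij: "i \<le> j"
  let ?y = "\<lambda>k. x (i + k)"
  have l: "l1 (x j - x i) = j - i"
    using l1_up_right_path[OF infinite_path_imp_up_right_path[OF x]] ij by blast
  have path: "path_between (x i) (x j) ?y"
    using x ij by (simp add: path_between_def up_right_path_def infinite_path_def l)
  have "passage \<omega> (j - i) ?y = b (x i) (x j)"
    using sum_telescope[of ?y "j - i"] ij by (simp add: passage_def eq)
  \<comment> \<open>A maximiser exists between the endpoints and obeys the bound
    \<open>b (x i) (x j)\<close>, which the given path attains.\<close>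
  then have "G \<omega> (x i) (x j) \<le> passage \<omega> (j - i) ?y"
    using geodesic_exists[of "x i" "x j" \<omega>] passage_le_busemann[of "x i" "x j"]
      up_right_path_mono[OF infinite_path_imp_up_right_path[OF x] ij order_refl]
    by (auto simp: geodesic_def l)
  then have "G \<omega> (x i) (x j) = passage \<omega> (l1 (x j - x i)) ?y"
    using passage_le_G[OF path, of \<omega>] by (simp add: l)
  then show "geodesic \<omega> (x i) (x j) ?y" using path by (simp add: geodesic_def)
qed

text \<open>The tail of the path itself serves as the admissible sequence: the increment over edge
  \<open>k\<close> towards any later site of the path equals \<open>\<omega> (x k)\<close>, so the
  limit does too.\<close>

lemma infinite_geodesic_imp_busemann:
  assumes x: "infinite_geodesic \<omega> x"
    and inf: "ereal (fst \<xi>l) \<le> liminf (\<lambda>n. ereal (real_of_int (fst (x n)) / real n))"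
    and sup: "limsup (\<lambda>n. ereal (real_of_int (fst (x n)) / real n)) \<le> ereal (fst \<xi>r)"
  shows "\<omega> (x k) = b (x k) (x (Suc k))"
proof -
  have path: "infinite_path x" using x by (simp add: infinite_geodesic_def)
  obtain N where v: "admissible \<xi>l \<xi>r (\<lambda>n. x (n + N))"
    using infinite_path_admissible[OF path pos less1 inf sup] .
  have "\<forall>\<^sub>F n in sequentially. \<omega> (x k) = G \<omega> (x k) (x (n + N)) - G \<omega> (x (Suc k)) (x (n + N))"
    using eventually_gt_at_top[of k]
  proof eventually_elim
    case (elim n)
    have "geodesic \<omega> (x k) (x (n + N)) (\<lambda>i. x (k + i))"
      using x elim by (simp add: infinite_geodesic_def)
    moreover have "l1 (x (n + N) - x k) = n + N - k"
      using l1_up_right_path[OF infinite_path_imp_up_right_path[OF path], of k "n + N" "n + N"] elim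
      by simp
    ultimately show ?case
      using geodesic_G_diff[of \<omega> "x k" _ "\<lambda>i. x (k + i)" 0] elim by simp
  qed
  then have "(\<lambda>n. G \<omega> (x k) (x (n + N)) - G \<omega> (x (Suc k)) (x (n + N))) \<longlonglongrightarrow> \<omega> (x k)"
    by (rule tendsto_eventually[OF eventually_mono]) simp
  then show ?thesis using LIMSEQ_unique[OF _ lim[OF v]] by blast
qed

text \<open>The geodesic to \<open>v n\<close> may be non-unique and may change with
  \<open>n\<close>, so the threshold is chosen for a finite set of pairs of sites rather than for a
  path.\<close>

lemma geodesics_eventually_busemann:
  assumes v: "admissible \<xi>l \<xi>r v"
  shows "\<forall>\<^sub>F n in sequentially. \<forall>x. geodesic \<omega> 0 (v n) x \<longrightarrow>
    (\<forall>i\<le>m. b (x i) (x (Suc i)) = \<omega> (x i))"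
proof -
  \<comment> \<open>Edges \<open>0\<close> to \<open>m\<close> have endpoints \<open>x 0\<close> to
    \<open>x (Suc m)\<close>, hence the bound \<open>Suc m\<close>. Pairs in \<open>S\<close> that
    are not edges do no harm, as the limit exists for every pair.\<close>
  define S :: "site set" where "S = {0..int (Suc m)} \<times> {0..int (Suc m)}"
  have "\<forall>\<^sub>F n in sequentially. \<forall>e\<in>S \<times> S.
      G \<omega> (fst e) (v n) - G \<omega> (snd e) (v n) = \<omega> (fst e) \<longrightarrow> b (fst e) (snd e) = \<omega> (fst e)"
  proof (rule eventually_ball_finite)
    show "finite (S \<times> S)" by (simp add: S_def)
    show "\<forall>e\<in>S \<times> S. \<forall>\<^sub>F n in sequentially.
      G \<omega> (fst e) (v n) - G \<omega> (snd e) (v n) = \<omega> (fst e) \<longrightarrow> b (fst e) (snd e) = \<omega> (fst e)"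
    proof
      fix e
      show "\<forall>\<^sub>F n in sequentially.
        G \<omega> (fst e) (v n) - G \<omega> (snd e) (v n) = \<omega> (fst e) \<longrightarrow> b (fst e) (snd e) = \<omega> (fst e)"
      proof (cases "b (fst e) (snd e) = \<omega> (fst e)")
        case False
        \<comment> \<open>If the limit differs from the weight, then so do the increments from some
          index on, and the premise of the implication fails.\<close>
        from tendsto_imp_eventually_ne[OF lim[OF v] this] show ?thesis
          by (rule eventually_mono) simp
      qed simp
    qed
  qed
  \<comment> \<open>Strictness makes edge \<open>m\<close>, and so each edge \<open>i\<close> with
    \<open>i \<le> m\<close>, part of the geodesic.\<close>
  moreover have "\<forall>\<^sub>F n in sequentially. m < l1 (v n)"
    using v by (auto simp: admissible_def filterlim_iff eventually_gt_at_top)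
  ultimately show ?thesis
  proof eventually_elim
    case (elim n)
    show ?case
    proof (intro allI impI)
      fix x i assume x: "geodesic \<omega> 0 (v n) x" and i: "i \<le> m"
      have p: "up_right_path (l1 (v n)) x" "x 0 = 0"
        using x by (auto simp: geodesic_def path_between_def)
      have S: "x j \<in> S" if "j \<le> Suc m" for j
        using up_right_path_mono[OF p(1), of 0 j] that elim(2) p(2)
        by (auto simp: S_def mem_Times_iff)
      have "G \<omega> (x i) (v n) - G \<omega> (x (Suc i)) (v n) = \<omega> (x i)"
        using geodesic_G_diff[OF x] i elim(2) by simp
      then show "b (x i) (x (Suc i)) = \<omega> (x i)"
        using elim(1) S[of i] S[of "Suc i"] i by force
    qed
  qed
qed

end

theorem theorem2p5:
  fixes P :: "env measure"
    and B :: "env \<Rightarrow> site \<Rightarrow> site \<Rightarrow> real"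
    and p c :: real
    and \<xi> \<xi>l \<xi>r :: "real \<times> real"
  assumes "prob_space P"
    and "sets P = sets borel"
    and "prob_space.indep_vars P (\<lambda>_. borel) (\<lambda>x \<omega>. \<omega> x) (UNIV :: site set)"
    and "\<And>x. distr P borel (\<lambda>\<omega>. \<omega> x) = distr P borel (\<lambda>\<omega>. \<omega> 0)"
    and "p > 2"
    and "integrable P (\<lambda>\<omega>. \<bar>\<omega> 0\<bar> powr p)"
    and "prob_space.variance P (\<lambda>\<omega>. \<omega> 0) > 0"
    and "\<P>(\<omega> in P. \<omega> 0 \<ge> c) = 1"
    and "\<xi> \<in> ri_U"
    and "U_at (gpp P) \<xi> = closed_segment \<xi>l \<xi>r"
    and "fst \<xi>l \<le> fst \<xi>r"
    and "{\<xi>l, \<xi>, \<xi>r} \<subseteq> diff_points (gpp P)"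
    and "is_busemann P \<xi>l \<xi>r B"
  shows
    "(AE \<omega> in P. \<forall>x. busemann_geodesic B \<omega> x \<longrightarrow> infinite_geodesic \<omega> x) \<and>
     (AE \<omega> in P. \<forall>x. infinite_geodesic \<omega> x \<and>
        ereal (fst \<xi>l) \<le> liminf (\<lambda>n. ereal (real_of_int (fst (x n)) / real n)) \<and>
        limsup (\<lambda>n. ereal (real_of_int (fst (x n)) / real n)) \<le> ereal (fst \<xi>r)
        \<longrightarrow> busemann_geodesic B \<omega> x) \<and>
     (AE \<omega> in P. \<forall>m v. admissible \<xi>l \<xi>r v \<longrightarrow>
        (\<exists>n0. \<forall>n\<ge>n0. \<forall>x. geodesic \<omega> 0 (v n) x \<longrightarrow>
           (\<forall>i\<le>m. B \<omega> (x i) (x (Suc i)) = \<omega> (x i))))"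
proof -
  \<comment> \<open>The endpoints are points of differentiability, which by definition lie in the
    relative interior.\<close>
  have \<xi>: "0 < fst \<xi>l" "fst \<xi>r < 1"
    using assms(12) fst_ri_U by (auto simp: diff_points_def)
  \<comment> \<open>The exceptional null set of \<open>is_busemann\<close> is the only one: all
    three claims hold for every environment outside it.\<close>
  have env: "AE \<omega> in P. busemann_environment \<omega> (B \<omega>) \<xi>l \<xi>r"
    using assms(13) unfolding is_busemann_def
    by (rule eventually_mono) (unfold_locales, use \<xi> assms(11) in auto)
  show ?thesis
  proof (intro conjI)
    show "AE \<omega> in P. \<forall>x. busemann_geodesic B \<omega> x \<longrightarrow> infinite_geodesic \<omega> x"
      using env by eventually_elim (auto simp: busemann_geodesic_def
          intro: busemann_environment.busemann_path_imp_infinite_geodesic)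
    show "AE \<omega> in P. \<forall>x. infinite_geodesic \<omega> x \<and>
        ereal (fst \<xi>l) \<le> liminf (\<lambda>n. ereal (real_of_int (fst (x n)) / real n)) \<and>
        limsup (\<lambda>n. ereal (real_of_int (fst (x n)) / real n)) \<le> ereal (fst \<xi>r)
        \<longrightarrow> busemann_geodesic B \<omega> x"
      \<comment> \<open>Unfolding \<open>infinite_geodesic\<close> exposes the
        \<open>infinite_path\<close> part of \<open>busemann_geodesic\<close>; the rule is unfolded
        likewise so that its premise still matches.\<close>
      using env by eventually_elim (auto simp: busemann_geodesic_def infinite_geodesic_def
          intro: busemann_environment.infinite_geodesic_imp_busemann[unfolded infinite_geodesic_def])
    show "AE \<omega> in P. \<forall>m v. admissible \<xi>l \<xi>r v \<longrightarrow>
        (\<exists>n0. \<forall>n\<ge>n0. \<forall>x. geodesic \<omega> 0 (v n) x \<longrightarrow>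
           (\<forall>i\<le>m. B \<omega> (x i) (x (Suc i)) = \<omega> (x i)))"
      using env by eventually_elim
        (use busemann_environment.geodesics_eventually_busemann in
          \<open>unfold eventually_sequentially, blast\<close>)
  qed
qed

end
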